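(* Let $(\lambda(n))_{n=-\infty}^{n=\infty}$ be a strictly increasing sequence of real numbers such that $\lambda(n)\to\infty$ as $n\to\infty$ and $\lambda(n)\to-\infty$ as $n\to-\infty$. Let $f$ be a function on an interval $[a,b]$ such that $f$ is continuous from the left at every point of the sequence $(\lambda(n))$ with $a<\lambda(n)\le b$. Let $(c(n))$ be a complex sequence and let $S(t)=\sum_{\lambda_0<\lambda(n)\le t}c(n)$, where $\lambda_0$ is a fixed constant. Then $$\sum_{a<\lambda(n)\le b}c(n)f(\lambda(n))=\int_a^b f(t)\,dS(t)=f(b)S(b)-f(a)S(a)-\int_a^b S(t)\,df(t).$$
   Context: The integrals with respect to $dS$ and $df$ are Riemann–Stieltjes integrals.
   Formalization: For t < λ_0, S(t) is taken as minus the sum of c(n) over t < λ(n) ≤ λ_0; with the empty sum the claim fails (λ(n)=n, a=0, b=1, λ_0=2, c=f=1). Riemann–Stieltjes integrals are limits along refinements of partitions, since f is only left-continuous. *)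

theory Defs
  imports Complex_Main
begin

definition is_partition :: "real \<Rightarrow> real \<Rightarrow> nat \<Rightarrow> (nat \<Rightarrow> real) \<Rightarrow> bool" where
  "is_partition a b n x \<longleftrightarrow> x 0 = a \<and> x n = b \<and> (\<forall>i<n. x i \<le> x (Suc i))"

(* Limit along refinements of partitions (as in Apostol), not along mesh size tending to 0:
   if f is only left-continuous at a jump of g, the mesh limit need not exist.
   Repeated partition points are allowed; they contribute 0 to the sum. *)
definition has_RS_integral ::
    "(real \<Rightarrow> complex) \<Rightarrow> (real \<Rightarrow> complex) \<Rightarrow> real \<Rightarrow> real \<Rightarrow> complex \<Rightarrow> bool" where
  "has_RS_integral f g a b I \<longleftrightarrow>
     (\<forall>\<epsilon>>0. \<exists>m p. is_partition a b m p \<and>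
        (\<forall>n x \<xi>. is_partition a b n x \<and> p ` {..m} \<subseteq> x ` {..n} \<and>
             (\<forall>i<n. x i \<le> \<xi> i \<and> \<xi> i \<le> x (Suc i)) \<longrightarrow>
           norm ((\<Sum>i<n. f (\<xi> i) * (g (x (Suc i)) - g (x i))) - I) < \<epsilon>))"

definition RS_integrable ::
    "(real \<Rightarrow> complex) \<Rightarrow> (real \<Rightarrow> complex) \<Rightarrow> real \<Rightarrow> real \<Rightarrow> bool" where
  "RS_integrable f g a b \<longleftrightarrow> (\<exists>I. has_RS_integral f g a b I)"

definition RS_integral ::
    "(real \<Rightarrow> complex) \<Rightarrow> (real \<Rightarrow> complex) \<Rightarrow> real \<Rightarrow> real \<Rightarrow> complex" where
  "RS_integral f g a b = (THE I. has_RS_integral f g a b I)"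

(* The sum of c n over l0 < lam n <= t, oriented in the same way as an integral from l0 to t:
   for t < l0 it is minus the sum over t < lam n <= l0. Reading it as an empty sum for t < l0
   would lose the jumps of S at the points lam n <= l0. *)
definition summatory :: "(int \<Rightarrow> real) \<Rightarrow> (int \<Rightarrow> complex) \<Rightarrow> real \<Rightarrow> real \<Rightarrow> complex" where
  "summatory lam c l0 t =
     (if l0 \<le> t then (\<Sum>n | l0 < lam n \<and> lam n \<le> t. c n)
      else - (\<Sum>n | t < lam n \<and> lam n \<le> l0. c n))"

end

theory Submission
  imports Defs
begin

text \<open>
  \<open>S\<close> is a step function whose jump at \<open>lam n\<close> is \<open>c n\<close>. If a partition contains every jump
  \<open>lam n\<close> of \<open>(a, b]\<close> together with a point slightly to the left of it, then in a
  Riemann--Stieltjes sum of any refinement the jump \<open>c n\<close> is multiplied by a value of \<open>f\<close> at a tag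
  that is close to \<open>lam n\<close> from the left, so left continuity suffices for convergence.
  Integration by parts holds for arbitrary integrands: summation by parts turns a sum for
  \<open>\<integral> g df\<close> with points \<open>x i\<close> and tags \<open>\<xi> i\<close> into a sum for \<open>\<integral> f dg\<close> with points
  \<open>x 0, \<xi> 0, x 1, \<xi> 1, \<dots>\<close> and tags among the \<open>x i\<close>.
\<close>

section \<open>Partitions and their sets of points\<close>

lemma is_partition_mono:
  assumes "is_partition a b n x" "i \<le> j" "j \<le> n"
  shows "x i \<le> x j"
  using assms(2,3)
proof (induction j rule: dec_induct)
  case (step k)
  moreover have "x k \<le> x (Suc k)"
    using assms(1) step by (auto simp: is_partition_def)
  ultimately show ?case by fastforce
qed simp

text \<open>The sorted list of a finite set is a partition once the set contains both endpoints.
  Refinement concerns only sets of points, so partitions can be prescribed, and common refinements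
  formed, as finite sets.\<close>

lemma ex_partition_image:
  assumes "finite A" "a \<in> A" "b \<in> A" "A \<subseteq> {a..b}"
  shows "\<exists>n x. is_partition a b n x \<and> x ` {..n} = A"
proof -
  define xs where "xs = sorted_list_of_set A"
  define n where "n = length xs - 1"
  have srt: "sorted xs" and set: "set xs = A"
    using assms(1) by (auto simp: xs_def)
  have "xs \<noteq> []" using set assms(2) by auto
  then have len: "length xs = Suc n" by (simp add: n_def)
  have img: "(\<lambda>i. xs ! i) ` {..n} = A"
    unfolding set[symmetric] set_conv_nth len by (auto simp: less_Suc_eq_le)
  have mono: "xs ! i \<le> xs ! j" if "i \<le> j" "j \<le> n" for i j
    using sorted_nth_mono[OF srt] that len by simp
  obtain i j where "i \<le> n" "xs ! i = a" "j \<le> n" "xs ! j = b"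
    using assms(2,3) img by blast
  then have "xs ! 0 \<le> a" "b \<le> xs ! n" using mono[of 0 i] mono[of j n] by auto
  moreover have "xs ! 0 \<in> A" "xs ! n \<in> A" using img by auto
  ultimately have "xs ! 0 = a" "xs ! n = b" using assms(4) by fastforce+
  then have "is_partition a b n (\<lambda>i. xs ! i)"
    using mono by (auto simp: is_partition_def)
  then show ?thesis using img by blast
qed

lemma is_partition_image_subset:
  assumes "is_partition a b n x"
  shows "x ` {..n} \<subseteq> {a..b}" "a \<in> x ` {..n}" "b \<in> x ` {..n}"
proof -
  show "x ` {..n} \<subseteq> {a..b}"
    using is_partition_mono[OF assms, of 0] is_partition_mono[OF assms, of _ n] assms
    by (auto simp: is_partition_def)
  show "a \<in> x ` {..n}" "b \<in> x ` {..n}"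
    using assms by (auto simp: is_partition_def)
qed

section \<open>Uniqueness of the integral and integration by parts\<close>

lemma has_RS_integralE:
  assumes "has_RS_integral f g a b I" "e > 0"
  obtains m p where "is_partition a b m p"
    and "\<And>n x \<xi>. is_partition a b n x \<Longrightarrow> p ` {..m} \<subseteq> x ` {..n} \<Longrightarrow>
      \<forall>i<n. x i \<le> \<xi> i \<and> \<xi> i \<le> x (Suc i) \<Longrightarrow>
      norm ((\<Sum>i<n. f (\<xi> i) * (g (x (Suc i)) - g (x i))) - I) < e"
proof -
  from assms obtain m p where mp: "is_partition a b m p \<and>
      (\<forall>n x \<xi>. is_partition a b n x \<and> p ` {..m} \<subseteq> x ` {..n} \<and>
        (\<forall>i<n. x i \<le> \<xi> i \<and> \<xi> i \<le> x (Suc i)) \<longrightarrow>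
        norm ((\<Sum>i<n. f (\<xi> i) * (g (x (Suc i)) - g (x i))) - I) < e)"
    unfolding has_RS_integral_def by (elim allE impE exE) auto
  show thesis
    by (rule that[of m p]) (use mp in simp_all)
qed

text \<open>A single Riemann-Stieltjes sum over a common refinement lies within half the distance of
  \<open>I\<close> and \<open>J\<close> from both values, which is impossible. This makes the
  definite description in \<open>RS_integral\<close> meaningful.\<close>

lemma has_RS_integral_unique:
  assumes "has_RS_integral f g a b I" "has_RS_integral f g a b J"
  shows "I = J"
proof (rule ccontr)
  assume "I \<noteq> J"
  define e where "e = norm (I - J) / 2"
  have "e > 0" using \<open>I \<noteq> J\<close> by (simp add: e_def)
  obtain m p where p: "is_partition a b m p"
    and I: "\<And>n x \<xi>. is_partition a b n x \<Longrightarrow> p ` {..m} \<subseteq> x ` {..n} \<Longrightarrow>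
      \<forall>i<n. x i \<le> \<xi> i \<and> \<xi> i \<le> x (Suc i) \<Longrightarrow>
      norm ((\<Sum>i<n. f (\<xi> i) * (g (x (Suc i)) - g (x i))) - I) < e"
    by (rule has_RS_integralE[OF assms(1) \<open>e > 0\<close>]) (rule that; simp)
  obtain k q where q: "is_partition a b k q"
    and J: "\<And>n x \<xi>. is_partition a b n x \<Longrightarrow> q ` {..k} \<subseteq> x ` {..n} \<Longrightarrow>
      \<forall>i<n. x i \<le> \<xi> i \<and> \<xi> i \<le> x (Suc i) \<Longrightarrow>
      norm ((\<Sum>i<n. f (\<xi> i) * (g (x (Suc i)) - g (x i))) - J) < e"
    by (rule has_RS_integralE[OF assms(2) \<open>e > 0\<close>]) (rule that; simp)
  obtain n x where x: "is_partition a b n x" "x ` {..n} = p ` {..m} \<union> q ` {..k}"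
    using ex_partition_image[of "p ` {..m} \<union> q ` {..k}" a b]
      is_partition_image_subset[OF p] is_partition_image_subset[OF q] by auto
  have tags: "\<forall>i<n. x i \<le> x i \<and> x i \<le> x (Suc i)"
    using x(1) by (auto simp: is_partition_def)
  define s where "s = (\<Sum>i<n. f (x i) * (g (x (Suc i)) - g (x i)))"
  have "norm (s - I) < e" "norm (s - J) < e"
    using I[OF x(1) _ tags] J[OF x(1) _ tags] x(2) by (auto simp: s_def)
  then have "norm (I - J) < 2 * e"
    using norm_triangle_ineq4[of "s - J" "s - I"] by simp
  then show False by (simp add: e_def)
qed

lemma RS_integral_eq:
  assumes "has_RS_integral f g a b I"
  shows "RS_integral f g a b = I"
  unfolding RS_integral_def using assms has_RS_integral_unique by (intro the_equality) blast+

lemma has_RS_integral_by_parts: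
  assumes "has_RS_integral f g a b I"
  shows "has_RS_integral g f a b (f b * g b - f a * g a - I)"
  unfolding has_RS_integral_def
proof (intro allI impI)
  fix e :: real assume "e > 0"
  obtain m p where p: "is_partition a b m p"
    and I: "\<And>n x \<xi>. is_partition a b n x \<Longrightarrow> p ` {..m} \<subseteq> x ` {..n} \<Longrightarrow>
      \<forall>i<n. x i \<le> \<xi> i \<and> \<xi> i \<le> x (Suc i) \<Longrightarrow>
      norm ((\<Sum>i<n. f (\<xi> i) * (g (x (Suc i)) - g (x i))) - I) < e"
    by (rule has_RS_integralE[OF assms \<open>e > 0\<close>]) (rule that; simp)
  have "norm ((\<Sum>i<n. g (\<xi> i) * (f (x (Suc i)) - f (x i))) - (f b * g b - f a * g a - I)) < e"
    if x: "is_partition a b n x" and sub: "p ` {..m} \<subseteq> x ` {..n}"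
      and tags: "\<forall>i<n. x i \<le> \<xi> i \<and> \<xi> i \<le> x (Suc i)" for n x \<xi>
  proof -
    \<comment> \<open>\<open>y\<close> interleaves points and tags, and \<open>\<eta>\<close>
      selects \<open>x i\<close> on \<open>[x i, \<xi> i]\<close> and \<open>x (Suc i)\<close> on
      \<open>[\<xi> i, x (Suc i)]\<close>. A tag may coincide with an endpoint, so \<open>y\<close>
      relies on repeated partition points being allowed.\<close>
    define y where "y j = (if even j then x (j div 2) else \<xi> (j div 2))" for j
    define \<eta> where "\<eta> j = (if even j then x (j div 2) else x (Suc (j div 2)))" for j
    have "x 0 = a" "x n = b" using x by (auto simp: is_partition_def)
    have between: "y j \<le> \<eta> j \<and> \<eta> j \<le> y (Suc j)" if "j < 2 * n" for j
    proof (cases "even j")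
      case True
      then have "j div 2 < n" using that by auto
      then show ?thesis using True tags by (simp add: y_def \<eta>_def)
    next
      case False
      then have "j div 2 < n" using that by auto
      then show ?thesis using False tags by (simp add: y_def \<eta>_def)
    qed
    then have y: "is_partition a b (2 * n) y"
      using \<open>x 0 = a\<close> \<open>x n = b\<close> unfolding is_partition_def
      by (auto simp: y_def[of 0] y_def[of "2 * n"] intro: order_trans)
    have "x ` {..n} \<subseteq> y ` {..2 * n}"
    proof
      fix z assume "z \<in> x ` {..n}"
      then obtain i where "i \<le> n" "z = y (2 * i)" by (auto simp: y_def)
      then show "z \<in> y ` {..2 * n}" by auto
    qed
    then have small: "norm ((\<Sum>j<2*n. f (\<eta> j) * (g (y (Suc j)) - g (y j))) - I) < e"
      using I[OF y] sub between by blast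
    \<comment> \<open>The terms \<open>2 * i\<close> and \<open>2 * i + 1\<close> together give the
      increment of \<open>f * g\<close> from \<open>x i\<close> to \<open>x (Suc i)\<close> minus
      the \<open>i\<close>-th term of the sum for the integral of \<open>g\<close> against
      \<open>f\<close>; the increments telescope.\<close>
    have sums: "(\<Sum>j<2*k. f (\<eta> j) * (g (y (Suc j)) - g (y j))) =
      f (x k) * g (x k) - f (x 0) * g (x 0) - (\<Sum>i<k. g (\<xi> i) * (f (x (Suc i)) - f (x i)))" for k
      by (induction k) (simp_all add: y_def \<eta>_def algebra_simps)
    \<comment> \<open>The two errors differ only in sign, so the partition \<open>p\<close> chosen
      for \<open>e\<close> serves both integrals.\<close>
    have "(\<Sum>i<n. g (\<xi> i) * (f (x (Suc i)) - f (x i))) - (f b * g b - f a * g a - I) =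
      - ((\<Sum>j<2*n. f (\<eta> j) * (g (y (Suc j)) - g (y j))) - I)"
      unfolding sums \<open>x 0 = a\<close> \<open>x n = b\<close> by simp
    then show ?thesis using small by (simp only: norm_minus_cancel)
  qed
  then show "\<exists>m p. is_partition a b m p \<and>
      (\<forall>n x \<xi>. is_partition a b n x \<and> p ` {..m} \<subseteq> x ` {..n} \<and>
        (\<forall>i<n. x i \<le> \<xi> i \<and> \<xi> i \<le> x (Suc i)) \<longrightarrow>
        norm ((\<Sum>i<n. g (\<xi> i) * (f (x (Suc i)) - f (x i))) - (f b * g b - f a * g a - I)) < e)"
    using p by (intro exI[of _ m] exI[of _ p]) simp
qed

section \<open>Sums over the indices with \<open>lam n\<close> in a half-open interval\<close>

lemma finite_indices_between:
  fixes lam :: "int \<Rightarrow> real"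
  assumes "filterlim lam at_top at_top" "filterlim lam at_bot at_bot"
  shows "finite {n. s < lam n \<and> lam n \<le> t}"
proof -
  obtain N where N: "\<And>n. n \<ge> N \<Longrightarrow> t < lam n"
    using assms(1) by (auto simp: filterlim_at_top_dense eventually_at_top_linorder)
  obtain M where M: "\<And>n. n \<le> M \<Longrightarrow> lam n \<le> s"
    using assms(2) by (auto simp: filterlim_at_bot eventually_at_bot_linorder)
  have "{n. s < lam n \<and> lam n \<le> t} \<subseteq> {M..N}"
    using N M by (auto simp: not_less[symmetric])
  then show ?thesis by (rule finite_subset) simp
qed

text \<open>The finiteness assumption makes these genuine sums: over an infinite set the value is 0
  by convention, and splitting could fail.\<close>

lemma sum_between_split:
  fixes lam :: "'i \<Rightarrow> real" and h :: "'i \<Rightarrow> 'a :: comm_monoid_add"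
  assumes "\<And>s t. finite {n. s < lam n \<and> lam n \<le> t}" "r \<le> s" "s \<le> t"
  shows "(\<Sum>n | r < lam n \<and> lam n \<le> t. h n) =
    (\<Sum>n | r < lam n \<and> lam n \<le> s. h n) + (\<Sum>n | s < lam n \<and> lam n \<le> t. h n)"
proof -
  have "{n. r < lam n \<and> lam n \<le> t} = {n. r < lam n \<and> lam n \<le> s} \<union> {n. s < lam n \<and> lam n \<le> t}"
    using assms(2,3) by auto
  then show ?thesis
    using assms(1) by (auto intro!: sum.union_disjoint)
qed

lemma sum_between_partition:
  fixes lam :: "'i \<Rightarrow> real" and h :: "'i \<Rightarrow> 'a :: comm_monoid_add"
  assumes fin: "\<And>s t. finite {n. s < lam n \<and> lam n \<le> t}" and x: "is_partition a b m x"
  shows "(\<Sum>i<m. \<Sum>n | x i < lam n \<and> lam n \<le> x (Suc i). h n) = (\<Sum>n | a < lam n \<and> lam n \<le> b. h n)"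
proof -
  have "(\<Sum>i<k. \<Sum>n | x i < lam n \<and> lam n \<le> x (Suc i). h n) = (\<Sum>n | x 0 < lam n \<and> lam n \<le> x k. h n)"
    if "k \<le> m" for k
    using that
  proof (induction k)
    case (Suc k)
    then show ?case
      using sum_between_split[OF fin, of "x 0" "x k" "x (Suc k)" h]
        is_partition_mono[OF x, of 0 k] is_partition_mono[OF x, of k "Suc k"] by simp
  next
    case 0
    have "{n. x 0 < lam n \<and> lam n \<le> x 0} = {}" by auto
    then show ?case by (simp only: lessThan_0 sum.empty)
  qed
  from this[of m] show ?thesis using x by (simp add: is_partition_def)
qed

text \<open>The oriented definition of \<open>summatory\<close> makes increments independent of the
  base point \<open>l0\<close>. The three cases place \<open>l0\<close> to the left of, inside or to
  the right of the interval.\<close>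

lemma summatory_diff:
  assumes fin: "\<And>s t. finite {n. s < lam n \<and> lam n \<le> t}" and "s \<le> t"
  shows "summatory lam c l0 t - summatory lam c l0 s = (\<Sum>n | s < lam n \<and> lam n \<le> t. c n)"
proof -
  consider "l0 \<le> s" | "s < l0" "l0 \<le> t" | "t < l0" by linarith
  then show ?thesis
  proof cases
    case 1
    then show ?thesis using sum_between_split[OF fin 1 \<open>s \<le> t\<close>, of c] \<open>s \<le> t\<close>
      by (simp add: summatory_def)
  next
    case 2
    then show ?thesis using sum_between_split[OF fin, of s l0 t c] by (simp add: summatory_def)
  next
    case 3
    then show ?thesis using sum_between_split[OF fin, of s t l0 c] \<open>s \<le> t\<close>
      by (simp add: summatory_def)
  qed
qed

section \<open>The integral against a step function\<close>

lemma has_RS_integral_summatory: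
  fixes lam :: "int \<Rightarrow> real"
  assumes fin: "\<And>s t. finite {n. s < lam n \<and> lam n \<le> t}" and "a \<le> b"
    and cont: "\<And>n. a < lam n \<Longrightarrow> lam n \<le> b \<Longrightarrow> continuous (at_left (lam n)) f"
  shows "has_RS_integral f (summatory lam c l0) a b (\<Sum>n | a < lam n \<and> lam n \<le> b. c n * f (lam n))"
  unfolding has_RS_integral_def
proof (intro allI impI)
  fix e :: real assume "e > 0"
  define N where "N = {n. a < lam n \<and> lam n \<le> b}"
  define C where "C = (\<Sum>n\<in>N. norm (c n))"
  \<comment> \<open>The final error is at most \<open>d * C\<close>; adding 1 to \<open>C\<close>
    avoids division by zero when all jumps in the interval vanish.\<close>
  define d where "d = e / (C + 1)"
  have "C \<ge> 0" by (simp add: C_def sum_nonneg)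
  then have "d > 0" using \<open>e > 0\<close> by (simp add: d_def)
  have "d * C < e"
    using \<open>C \<ge> 0\<close> \<open>e > 0\<close> by (simp add: d_def field_simps)
  have "\<exists>l<lam n. \<forall>y. l < y \<and> y \<le> lam n \<longrightarrow> norm (f y - f (lam n)) < d" if "n \<in> N" for n
  proof -
    have "(f \<longlongrightarrow> f (lam n)) (at_left (lam n))"
      using cont[of n] that by (simp add: N_def continuous_within)
    then have "\<forall>\<^sub>F y in at_left (lam n). dist (f y) (f (lam n)) < d"
      using \<open>d > 0\<close> by (rule tendstoD)
    then obtain l where "l < lam n" "\<And>y. l < y \<Longrightarrow> y < lam n \<Longrightarrow> norm (f y - f (lam n)) < d"
      unfolding eventually_at_left_field dist_norm by blast
    then show ?thesis using \<open>d > 0\<close> by (metis diff_self norm_zero order_le_less)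
  qed
  then obtain l where l: "\<And>n. n \<in> N \<Longrightarrow> l n < lam n"
    "\<And>n y. n \<in> N \<Longrightarrow> l n < y \<Longrightarrow> y \<le> lam n \<Longrightarrow> norm (f y - f (lam n)) < d"
    by metis
  \<comment> \<open>\<open>q n\<close> is the guard point to the left of \<open>lam n\<close>: the
    midpoint puts it strictly between \<open>l n\<close> and \<open>lam n\<close>, and the maximum
    keeps it in \<open>[a, b]\<close>, still below \<open>lam n\<close> because
    \<open>a < lam n\<close>.\<close>
  define q where "q n = max a ((l n + lam n) / 2)" for n
  have q: "l n < q n" "q n < lam n" "q n \<in> {a..b}" if "n \<in> N" for n
    using l(1)[OF that] that by (auto simp: q_def N_def less_max_iff_disj)
  define A where "A = {a, b} \<union> lam ` N \<union> q ` N"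
  have "finite N" using fin by (simp add: N_def)
  moreover have "A \<subseteq> {a..b}"
    using q(3) \<open>a \<le> b\<close> by (auto simp: A_def N_def)
  ultimately obtain m p where p: "is_partition a b m p" "p ` {..m} = A"
    using ex_partition_image[of A a b] \<open>A \<subseteq> {a..b}\<close> by (auto simp: A_def)
  have "norm ((\<Sum>i<k. f (\<xi> i) * (summatory lam c l0 (x (Suc i)) - summatory lam c l0 (x i))) -
      (\<Sum>n\<in>N. c n * f (lam n))) < e"
    if x: "is_partition a b k x" and sub: "A \<subseteq> x ` {..k}"
      and tags: "\<forall>i<k. x i \<le> \<xi> i \<and> \<xi> i \<le> x (Suc i)" for k x \<xi>
  proof -
    define B where "B i = {n. x i < lam n \<and> lam n \<le> x (Suc i)}" for i
    have B: "norm (f (\<xi> i) - f (lam n)) < d" if "i < k" "n \<in> B i" for i n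
    proof -
      have "a \<le> x i" "x (Suc i) \<le> b"
        using is_partition_image_subset(1)[OF x] \<open>i < k\<close> by (auto simp: image_subset_iff)
      then have "n \<in> N" using that by (auto simp: B_def N_def)
      \<comment> \<open>No partition point lies strictly between two consecutive ones.\<close>
      have step: "x j \<le> x i \<or> x (Suc i) \<le> x j" if "j \<le> k" for j
        using is_partition_mono[OF x, of j i] is_partition_mono[OF x, of "Suc i" j] that \<open>i < k\<close>
        by (cases "j \<le> i") auto
      have "lam n \<in> x ` {..k}" "q n \<in> x ` {..k}"
        using sub \<open>n \<in> N\<close> by (auto simp: A_def)
      \<comment> \<open>As a partition point in \<open>(x i, x (Suc i)]\<close>,
        \<open>lam n\<close> is the right endpoint; \<open>q n\<close> is a partition point below
        it, hence at most \<open>x i\<close>. So \<open>\<xi> i\<close> lies in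
        \<open>(l n, lam n]\<close>, where \<open>f\<close> is \<open>d\<close>-close to
        \<open>f (lam n)\<close>.\<close>
      then have "lam n = x (Suc i)" "q n \<le> x i"
        using step that(2) q(2)[OF \<open>n \<in> N\<close>] by (fastforce simp: B_def)+
      then show ?thesis
        using l(2)[OF \<open>n \<in> N\<close>, of "\<xi> i"] q(1)[OF \<open>n \<in> N\<close>] tags \<open>i < k\<close> by fastforce
    qed
    \<comment> \<open>The codomain of \<open>h\<close> is left general because the regrouping is
      applied both to the complex sum and to the real bound.\<close>
    have part: "(\<Sum>i<k. \<Sum>n\<in>B i. h n) = (\<Sum>n\<in>N. h n)" for h :: "int \<Rightarrow> 'b :: comm_monoid_add"
      using sum_between_partition[OF fin x, of h] by (simp add: B_def N_def)
    have diff: "summatory lam c l0 (x (Suc i)) - summatory lam c l0 (x i) = (\<Sum>n\<in>B i. c n)"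
      if "i < k" for i
      using summatory_diff[OF fin, where c = c] x that by (simp add: B_def is_partition_def)
    have "(\<Sum>i<k. f (\<xi> i) * (summatory lam c l0 (x (Suc i)) - summatory lam c l0 (x i))) -
        (\<Sum>n\<in>N. c n * f (lam n)) = (\<Sum>i<k. \<Sum>n\<in>B i. c n * (f (\<xi> i) - f (lam n)))"
      unfolding part[symmetric]
      by (simp add: diff sum_distrib_left sum_subtractf[symmetric] algebra_simps)
    also have "norm \<dots> \<le> (\<Sum>i<k. \<Sum>n\<in>B i. norm (c n) * d)"
      by (intro sum_norm_le) (auto simp: norm_mult intro!: mult_left_mono less_imp_le[OF B])
    also have "\<dots> = d * C"
      unfolding part by (simp add: C_def sum_distrib_left mult.commute)
    finally show ?thesis using \<open>d * C < e\<close> by linarith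
  qed
  then show "\<exists>m p. is_partition a b m p \<and>
      (\<forall>k x \<xi>. is_partition a b k x \<and> p ` {..m} \<subseteq> x ` {..k} \<and>
        (\<forall>i<k. x i \<le> \<xi> i \<and> \<xi> i \<le> x (Suc i)) \<longrightarrow>
        norm ((\<Sum>i<k. f (\<xi> i) * (summatory lam c l0 (x (Suc i)) - summatory lam c l0 (x i))) -
          (\<Sum>n | a < lam n \<and> lam n \<le> b. c n * f (lam n))) < e)"
    using p by (intro exI[of _ m] exI[of _ p]) (simp add: N_def)
qed

text \<open>Integrability of both pairs belongs to the conclusion because \<open>RS_integral\<close>
  is a definite description, so an equation for it carries the intended meaning only when the
  integral exists.\<close>

theorem lemma1:
  fixes lam :: "int \<Rightarrow> real" and c :: "int \<Rightarrow> complex"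
    and f S :: "real \<Rightarrow> complex" and a b l0 :: real
  assumes "strict_mono lam"
    and "filterlim lam at_top at_top"
    and "filterlim lam at_bot at_bot"
    and "a \<le> b"
    and "\<And>n. a < lam n \<Longrightarrow> lam n \<le> b \<Longrightarrow> continuous (at_left (lam n)) f"
    and "S = summatory lam c l0"
  shows "RS_integrable f S a b \<and> RS_integrable S f a b \<and>
    (\<Sum>n | a < lam n \<and> lam n \<le> b. c n * f (lam n)) = RS_integral f S a b \<and>
    RS_integral f S a b = f b * S b - f a * S a - RS_integral S f a b"
proof -
  let ?I = "\<Sum>n | a < lam n \<and> lam n \<le> b. c n * f (lam n)"
  have fS: "has_RS_integral f S a b ?I"
    unfolding assms(6)
    using finite_indices_between[OF assms(2,3)] assms(4,5) by (rule has_RS_integral_summatory)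
  note Sf = has_RS_integral_by_parts[OF fS]
  show ?thesis
    using fS Sf RS_integral_eq[OF fS] RS_integral_eq[OF Sf] by (auto simp: RS_integrable_def)
qed

end
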